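(* Let $K$ be a field and let $R$ be a standard graded polynomial ring in finitely many indeterminates over $K$. Let $I,J,N\subset R$ be homogeneous, saturated, unmixed ideals such that $N\subseteq I\cap J$ and $\mathrm{ht}(I)=\mathrm{ht}(J)=\mathrm{ht}(N)+1$. Assume that $N$ is Cohen-Macaulay. Let $\sigma$ be a term-order on $R$, and let $A,B,C\subset R$ be monomial ideals such that $C\subseteq \mathrm{in}(J)$, $A=\mathrm{in}(N)$ and $B=\mathrm{in}(I)$, where initial ideals are taken with respect to $\sigma$. Assume that $A$ is Cohen-Macaulay and that $\mathrm{ht}(B)=\mathrm{ht}(A)+1$. Suppose that $J$ is obtained from $I$ via an elementary biliaison of height $\ell$ on $N$, and that $C$ is a Basic Double Link of degree $\ell$ of $B$ on $A$. Then $C=\mathrm{in}(J)$.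
   Context: $\mathrm{in}(I)$ denotes the initial ideal of $I$ with respect to $\sigma$, and $\mathrm{ht}$ denotes the height of an ideal. An ideal $\mathfrak a\subset R$ is called Cohen-Macaulay if $R/\mathfrak a$ is a Cohen-Macaulay ring. Elementary biliaison: let $I,J\subset R$ be homogeneous, saturated, unmixed ideals with $\mathrm{ht}(I)=\mathrm{ht}(J)=c$, and let $N\subseteq I\cap J$ be a Cohen-Macaulay ideal of $R$ of height $c-1$. One says that $J$ is obtained from $I$ via an elementary biliaison of height $\ell$ on $N$ if $J/N\cong [I/N](-\ell)$ as (graded) $R/N$-modules. Basic Double Link: let $A\subset B\subset R$ be homogeneous ideals such that $\mathrm{ht}(A)=\mathrm{ht}(B)-1$ and $R/A$ is Cohen-Macaulay. Let $f\in R_d$ be a homogeneous element of degree $d$ such that $A:f=A$. Then $C:=A+fB$ is called a Basic Double Link of degree $d$ of $B$ on $A$. *)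

theory Defs
  imports
    "HOL-Algebra.Algebra"
    "HOL-Algebra.Algebraic_Closure_Type"
    "HOL-Library.Poly_Mapping"
    "HOL-Library.Extended_Nat"
begin

section \<open>Commutative rings: height, unmixedness, Cohen-Macaulayness\<close>

text \<open>For a prime \<open>P\<close>: the supremum of the lengths \<open>n\<close> of chains \<open>P0 \<subset> ... \<subset> Pn = P\<close> of primes.\<close>

definition prime_height :: "('a, 'm) ring_scheme \<Rightarrow> 'a set \<Rightarrow> enat" where
  "prime_height R P = Sup {enat n |n. \<exists>Q :: nat \<Rightarrow> 'a set.
     (\<forall>i\<le>n. primeideal (Q i) R) \<and> (\<forall>i<n. Q i \<subset> Q (Suc i)) \<and> Q n = P}"

text \<open>The unit ideal has height \<open>\<infinity>\<close>, being an infimum over the empty set.\<close>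

definition height :: "('a, 'm) ring_scheme \<Rightarrow> 'a set \<Rightarrow> enat" where
  "height R I = Inf (prime_height R ` {P. primeideal P R \<and> I \<subseteq> P})"

text \<open>The associated primes of the module \<open>R/I\<close>, i.e. the primes of the form \<open>I : x\<close>.\<close>

definition associated_primes :: "('a, 'm) ring_scheme \<Rightarrow> 'a set \<Rightarrow> 'a set set" where
  "associated_primes R I =
     {P. primeideal P R \<and> (\<exists>x \<in> carrier R. P = {r \<in> carrier R. r \<otimes>\<^bsub>R\<^esub> x \<in> I})}"

definition unmixed :: "('a, 'm) ring_scheme \<Rightarrow> 'a set \<Rightarrow> bool" where
  "unmixed R I \<longleftrightarrow> ideal I R \<and> (\<forall>P \<in> associated_primes R I. height R P = height R I)"

text \<open>Each entry is a nonzerodivisor modulo the ideal generated by the preceding ones,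
  and the whole sequence generates a proper ideal.\<close>

definition regular_sequence :: "('a, 'm) ring_scheme \<Rightarrow> 'a list \<Rightarrow> bool" where
  "regular_sequence R xs \<longleftrightarrow>
     set xs \<subseteq> carrier R \<and>
     (\<forall>i < length xs. \<forall>y \<in> carrier R.
        xs ! i \<otimes>\<^bsub>R\<^esub> y \<in> Idl\<^bsub>R\<^esub> (set (take i xs)) \<longrightarrow> y \<in> Idl\<^bsub>R\<^esub> (set (take i xs))) \<and>
     Idl\<^bsub>R\<^esub> (set xs) \<noteq> carrier R"

definition depth :: "('a, 'm) ring_scheme \<Rightarrow> 'a set \<Rightarrow> enat" where
  "depth R I = Sup {enat (length xs) |xs. regular_sequence R xs \<and> set xs \<subseteq> I}"

text \<open>The definition of Eisenbud, Commutative Algebra, Section 18.2: a Noetherian ring in which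
  the depth of every maximal ideal \<open>\<mm>\<close> on \<open>R\<close> equals the height of \<open>\<mm>\<close>. No localization is
  needed, since these numbers are the depth and the dimension of the local ring at \<open>\<mm>\<close>.
  The zero ring is included.\<close>

definition cohen_macaulay_ring :: "('a, 'm) ring_scheme \<Rightarrow> bool" where
  "cohen_macaulay_ring R \<longleftrightarrow>
     cring R \<and> noetherian_ring R \<and> (\<forall>M. maximalideal M R \<longrightarrow> depth R M = height R M)"

definition cohen_macaulay_ideal :: "('a, 'm) ring_scheme \<Rightarrow> 'a set \<Rightarrow> bool" where
  "cohen_macaulay_ideal R I \<longleftrightarrow> ideal I R \<and> cohen_macaulay_ring (R Quot I)"


section \<open>Graded modules\<close>

record ('a, 'b) graded_module = "('a, 'b) module" +
  component :: "int \<Rightarrow> 'b set"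

text \<open>The shifted module \<open>M(s)\<close>, with \<open>M(s)\<^sub>d = M\<^sub>s\<^sub>+\<^sub>d\<close>.\<close>

definition degree_shift :: "('a, 'b) graded_module \<Rightarrow> int \<Rightarrow> ('a, 'b) graded_module" where
  "degree_shift M s = M\<lparr>component := (\<lambda>d. component M (s + d))\<rparr>"

text \<open>Isomorphism of graded modules over \<open>S\<close>; isomorphisms preserve degrees.\<close>

definition graded_module_iso ::
  "('a, 'm) ring_scheme \<Rightarrow> ('a, 'b) graded_module \<Rightarrow> ('a, 'c) graded_module \<Rightarrow> bool" where
  "graded_module_iso S M M' \<longleftrightarrow>
     (\<exists>\<phi>. bij_betw \<phi> (carrier M) (carrier M') \<and>
        (\<forall>x \<in> carrier M. \<forall>y \<in> carrier M. \<phi> (x \<oplus>\<^bsub>M\<^esub> y) = \<phi> x \<oplus>\<^bsub>M'\<^esub> \<phi> y) \<and>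
        (\<forall>a \<in> carrier S. \<forall>x \<in> carrier M. \<phi> (a \<odot>\<^bsub>M\<^esub> x) = a \<odot>\<^bsub>M'\<^esub> \<phi> x) \<and>
        (\<forall>d. \<phi> ` component M d = component M' d))"


section \<open>The standard graded polynomial ring\<close>

text \<open>Monomials are exponent vectors \<open>'n \<Rightarrow>\<^sub>0 nat\<close>, so they are multiplied by \<open>+\<close> and the
  monomial \<open>1\<close> is \<open>0\<close>. The indeterminates are indexed by the finite type \<open>'n\<close>.\<close>

type_synonym 'n monomial = "'n \<Rightarrow>\<^sub>0 nat"
type_synonym ('n, 'k) mpoly = "'n monomial \<Rightarrow>\<^sub>0 'k"

abbreviation mpoly_ring :: "('n::finite, 'k::field) mpoly ring" where
  "mpoly_ring \<equiv> ring_of_type_algebra"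

definition monomial_poly :: "'n monomial \<Rightarrow> ('n, 'k::field) mpoly" where
  "monomial_poly m = Poly_Mapping.single m 1"

definition mon_degree :: "'n::finite monomial \<Rightarrow> nat" where
  "mon_degree m = (\<Sum>i\<in>UNIV. Poly_Mapping.lookup m i)"

text \<open>The degree-\<open>d\<close> component \<open>R\<^sub>d\<close>; it is zero for negative \<open>d\<close>.\<close>

definition homogeneous_part :: "int \<Rightarrow> ('n::finite, 'k::field) mpoly set" where
  "homogeneous_part d = {f. \<forall>m \<in> Poly_Mapping.keys f. int (mon_degree m) = d}"

definition homogeneous_ideal :: "('n::finite, 'k::field) mpoly set \<Rightarrow> bool" where
  "homogeneous_ideal I \<longleftrightarrow> (\<exists>S \<subseteq> (\<Union>d. homogeneous_part d). I = Idl\<^bsub>mpoly_ring\<^esub> S)"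

definition monomial_ideal :: "('n::finite, 'k::field) mpoly set \<Rightarrow> bool" where
  "monomial_ideal I \<longleftrightarrow> (\<exists>S. I = Idl\<^bsub>mpoly_ring\<^esub> (monomial_poly ` S))"

definition irrelevant_ideal :: "('n::finite, 'k::field) mpoly set" where
  "irrelevant_ideal = Idl\<^bsub>mpoly_ring\<^esub> (range (\<lambda>i. monomial_poly (Poly_Mapping.single i 1)))"

text \<open>The saturation \<open>I : \<mm>\<^sup>\<infinity>\<close> with respect to the irrelevant ideal \<open>\<mm>\<close>; the power
  \<open>\<mm>\<^sup>k\<close> is taken in the monoid of ideals.\<close>

definition saturation :: "('n::finite, 'k::field) mpoly set \<Rightarrow> ('n, 'k) mpoly set" where
  "saturation I =
     {f. \<exists>k::nat. \<forall>g \<in> irrelevant_ideal [^]\<^bsub>ideals_set mpoly_ring\<^esub> k. f * g \<in> I}"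

definition saturated :: "('n::finite, 'k::field) mpoly set \<Rightarrow> bool" where
  "saturated I \<longleftrightarrow> saturation I = I"


section \<open>Initial ideals\<close>

text \<open>\<open>(a, b) \<in> \<sigma>\<close> means \<open>a \<le> b\<close>.\<close>

definition term_order :: "'n monomial rel \<Rightarrow> bool" where
  "term_order \<sigma> \<longleftrightarrow>
     linear_order \<sigma> \<and> (\<forall>a. (0, a) \<in> \<sigma>) \<and> (\<forall>a b c. (a, b) \<in> \<sigma> \<longrightarrow> (a + c, b + c) \<in> \<sigma>)"

text \<open>The leading monomial of \<open>f\<close>; only meaningful for \<open>f \<noteq> 0\<close>.\<close>

definition leading_monomial :: "'n monomial rel \<Rightarrow> ('n, 'k::field) mpoly \<Rightarrow> 'n monomial" where
  "leading_monomial \<sigma> f =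
     (THE m. m \<in> Poly_Mapping.keys f \<and> (\<forall>m' \<in> Poly_Mapping.keys f. (m', m) \<in> \<sigma>))"

definition initial_ideal ::
  "'n::finite monomial rel \<Rightarrow> ('n, 'k::field) mpoly set \<Rightarrow> ('n, 'k) mpoly set" where
  "initial_ideal \<sigma> I = Idl\<^bsub>mpoly_ring\<^esub> {monomial_poly (leading_monomial \<sigma> f) |f. f \<in> I \<and> f \<noteq> 0}"


section \<open>Elementary biliaison and Basic Double Links\<close>

text \<open>For ideals \<open>N \<subseteq> I\<close>: the graded \<open>R/N\<close>-module \<open>I/N\<close>. Its multiplication and its unit are
  unused fields of the library's module record.\<close>

definition ideal_quotient ::
  "('n::finite, 'k::field) mpoly set \<Rightarrow> ('n, 'k) mpoly set
     \<Rightarrow> (('n, 'k) mpoly set, ('n, 'k) mpoly set) graded_module" where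
  "ideal_quotient I N =
     \<lparr>carrier = (\<lambda>f. N +>\<^bsub>mpoly_ring\<^esub> f) ` I,
      monoid.mult = monoid.mult (mpoly_ring Quot N), monoid.one = monoid.one (mpoly_ring Quot N),
      ring.zero = ring.zero (mpoly_ring Quot N), ring.add = ring.add (mpoly_ring Quot N),
      module.smult = monoid.mult (mpoly_ring Quot N),
      component = (\<lambda>d. (\<lambda>f. N +>\<^bsub>mpoly_ring\<^esub> f) ` (I \<inter> homogeneous_part d))\<rparr>"

text \<open>\<open>J\<close> is obtained from \<open>I\<close> via an elementary biliaison of height \<open>l\<close> on \<open>N\<close>.\<close>

definition elementary_biliaison ::
  "('n::finite, 'k::field) mpoly set \<Rightarrow> ('n, 'k) mpoly set \<Rightarrow> ('n, 'k) mpoly set \<Rightarrow> int \<Rightarrow> bool" where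
  "elementary_biliaison I J N l \<longleftrightarrow>
     homogeneous_ideal I \<and> saturated I \<and> unmixed mpoly_ring I \<and>
     homogeneous_ideal J \<and> saturated J \<and> unmixed mpoly_ring J \<and>
     N \<subseteq> I \<inter> J \<and> cohen_macaulay_ideal mpoly_ring N \<and>
     height mpoly_ring I = height mpoly_ring J \<and>
     height mpoly_ring I = height mpoly_ring N + 1 \<and>
     graded_module_iso (mpoly_ring Quot N) (ideal_quotient J N) (degree_shift (ideal_quotient I N) (- l))"

text \<open>\<open>C\<close> is a Basic Double Link of degree \<open>d\<close> of \<open>B\<close> on \<open>A\<close>.\<close>

definition basic_double_link ::
  "('n::finite, 'k::field) mpoly set \<Rightarrow> ('n, 'k) mpoly set \<Rightarrow> ('n, 'k) mpoly set \<Rightarrow> int \<Rightarrow> bool" where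
  "basic_double_link C B A d \<longleftrightarrow>
     homogeneous_ideal A \<and> homogeneous_ideal B \<and> A \<subseteq> B \<and>
     height mpoly_ring B = height mpoly_ring A + 1 \<and>
     cohen_macaulay_ideal mpoly_ring A \<and>
     (\<exists>f \<in> homogeneous_part d. {r. r * f \<in> A} = A \<and> C = {a + f * b |a b. a \<in> A \<and> b \<in> B})"

end

theory Submission
  imports Defs
begin

text \<open>
  A homogeneous ideal and its initial ideal have the same Hilbert function, so in degree \<open>d\<close> the dimension
  of \<open>in(J)\<^sub>d\<close> is that of \<open>J\<^sub>d\<close> (\<open>dim_initial_ideal_part\<close>). The biliaison identifies \<open>J/N\<close> with
  \<open>[I/N](-l)\<close>, hence
    \<open>dim J\<^sub>d - dim N\<^sub>d = dim I\<^bsub>d-l\<^esub> - dim N\<^bsub>d-l\<^esub>\<close>.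
  On the monomial side \<open>C = A + fB\<close>, and since \<open>f\<close> is a nonzerodivisor modulo \<open>A\<close>, multiplication
  by \<open>f\<close> identifies \<open>(B/A)(-l)\<close> with \<open>C/A\<close>, hence
    \<open>dim C\<^sub>d - dim A\<^sub>d = dim B\<^bsub>d-l\<^esub> - dim A\<^bsub>d-l\<^esub>\<close>.
  As \<open>A = in(N)\<close> and \<open>B = in(I)\<close>, the right-hand sides agree and \<open>dim A\<^sub>d = dim N\<^sub>d\<close>. So \<open>C\<^sub>d\<close> and
  \<open>in(J)\<^sub>d\<close> have the same finite dimension, and the inclusion \<open>C \<subseteq> in(J)\<close> is an equality.

  Only one inequality in each of the two counts matters, and both are instances of the same
  principle: a map that is linear modulo \<open>W'\<close> and injective modulo \<open>W\<close> bounds \<open>dim (V/W)\<close> by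
  \<open>dim (V'/W')\<close> (\<open>dim_quotient_mono\<close>). The two applications are \<open>biliaison_dim_le\<close> and
  \<open>basic_double_link_dim_le\<close>.
\<close>

section \<open>Dimension counts in vector spaces\<close>

text \<open>The polynomial ring is infinite-dimensional, whereas its graded pieces are not; finiteness is
  therefore a property of a subset and not of the ambient space.\<close>

definition (in vector_space) finite_span :: "'b set \<Rightarrow> bool" where
  "finite_span V \<longleftrightarrow> (\<exists>F. finite F \<and> V \<subseteq> span F)"

lemma (in vector_space) independent_finite_span:
  assumes "finite_span V" "E \<subseteq> V" "independent E"
  shows "finite E"
  using assms independent_span_bound unfolding finite_span_def by (meson order_trans)

lemma (in vector_space) independent_card_le_dim_finite_span:
  assumes "finite_span V" "E \<subseteq> V" "independent E"
  shows "card E \<le> dim V"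
proof -
  obtain B where B: "B \<subseteq> V" "independent B" "V \<subseteq> span B" "card B = dim V"
    using basis_exists by blast
  then have "finite B"
    using independent_finite_span assms(1) by blast
  then show ?thesis
    using independent_span_bound[of B E] assms B by auto
qed

lemma (in vector_space) subspace_eq_of_dim_le:
  assumes "subspace U" "finite_span V" "U \<subseteq> V" "dim V \<le> dim U"
  shows "U = V"
proof
  show "V \<subseteq> U"
  proof
    fix v assume v: "v \<in> V"
    obtain B where B: "B \<subseteq> U" "independent B" "U \<subseteq> span B" "card B = dim U"
      using basis_exists by blast
    have "finite B"
      using independent_finite_span[OF assms(2)] B assms(3) by blast
    show "v \<in> U"
    proof (rule ccontr)
      assume "v \<notin> U"
      moreover have "span B \<subseteq> U"
        using B(1) assms(1) by (rule span_minimal)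
      ultimately have "v \<notin> span B" by blast
      then have "independent (insert v B)"
        using B(2) by (rule independent_insertI)
      moreover have "v \<notin> B"
        using \<open>v \<notin> span B\<close> span_base by blast
      moreover have "insert v B \<subseteq> V"
        using v B(1) assms(3) by auto
      ultimately have "Suc (card B) \<le> dim V"
        using independent_card_le_dim_finite_span[OF assms(2), of "insert v B"] \<open>finite B\<close>
        by simp
      then show False
        using assms(4) B(4) by simp
    qed
  qed
qed (rule assms(3))

text \<open>The inequality \<open>dim (V/W) \<le> dim (V'/W')\<close> for an injective linear map \<open>V/W \<rightarrow> V'/W'\<close>, in a form
  without quotient spaces or subtraction. The map is given by a choice \<open>\<psi>\<close> of representatives, which
  is linear only modulo \<open>W'\<close>. The reason is the usual one: the images of a basis of \<open>V\<close> modulo \<open>W\<close>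
  remain independent of a basis of \<open>W'\<close>.\<close>

lemma (in vector_space) dim_quotient_mono:
  assumes sub: "subspace V" "subspace W" "subspace W'"
    and le: "W \<subseteq> V" "W' \<subseteq> V'"
    and fin: "finite_span V" "finite_span V'"
    and maps: "\<And>v. v \<in> V \<Longrightarrow> \<psi> v \<in> V'"
    and add: "\<And>v w. v \<in> V \<Longrightarrow> w \<in> V \<Longrightarrow> \<psi> (v + w) - (\<psi> v + \<psi> w) \<in> W'"
    and smult: "\<And>c v. v \<in> V \<Longrightarrow> \<psi> (c *s v) - c *s \<psi> v \<in> W'"
    and ker: "\<And>v. v \<in> V \<Longrightarrow> \<psi> v \<in> W' \<Longrightarrow> v \<in> W"
  shows "dim V + dim W' \<le> dim V' + dim W"
proof -
  obtain D where D: "D \<subseteq> W" "independent D" "W \<subseteq> span D" "card D = dim W"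
    using basis_exists by blast
  obtain D' where D': "D' \<subseteq> W'" "independent D'" "W' \<subseteq> span D'" "card D' = dim W'"
    using basis_exists by blast
  have spanD': "span D' = W'"
    using span_subspace D' sub(3) by blast
  obtain E where E: "D \<subseteq> E" "E \<subseteq> V" "independent E" "V \<subseteq> span E"
    using maximal_independent_subset_extend[of D V] D(1,2) le(1) by blast
  have finE: "finite E"
    using independent_finite_span[OF fin(1)] E by blast
  have cardE: "card E = dim V"
    using basis_card_eq_dim E by blast
  have finD': "finite D'"
    using independent_finite_span[OF fin(2)] D' le(2) by blast
  \<comment> \<open>The images of the basis vectors outside \<open>W\<close> can be adjoined one at a time.\<close>
  have "independent (\<psi> ` F \<union> D') \<and> card (\<psi> ` F \<union> D') = card F + card D'
      \<and> \<psi> ` F \<union> D' \<subseteq> V'"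
    if "F \<subseteq> E - D" for F
    using finite_subset[OF that finite_Diff[OF finE]] that
  proof (induction F rule: finite_induct)
    case empty
    then show ?case using D' le(2) by auto
  next
    case (insert e F)
    have eE: "e \<in> E" "e \<notin> D" "F \<subseteq> E - D" and eV: "e \<in> V" "F \<subseteq> V"
      using insert.prems E(2) by auto
    have spanFV: "span F \<subseteq> V"
      using eV(2) sub(1) by (rule span_minimal)
    \<comment> \<open>Linearity modulo \<open>W'\<close> extends from single vectors to linear combinations.\<close>
    have shape: "\<exists>v\<in>span F. x - \<psi> v \<in> W'" if "x \<in> span (\<psi> ` F \<union> D')" for x
      using that
    proof (induction rule: span_induct_alt)
      case base
      have "\<psi> (0 *s 0) - 0 *s \<psi> 0 \<in> W'"
        using smult subspace_0[OF sub(1)] by blast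
      then have "0 - \<psi> 0 \<in> W'"
        using subspace_neg[OF sub(3)] by fastforce
      then show ?case
        using span_zero by blast
    next
      case (step c x y)
      then obtain v where v: "v \<in> span F" "y - \<psi> v \<in> W'" by blast
      consider a where "a \<in> F" "x = \<psi> a" | "x \<in> D'"
        using step(1) by blast
      then show ?case
      proof cases
        case 1
        have aV: "a \<in> V" "c *s a \<in> V" "v \<in> V"
          using 1 eV sub(1) v(1) spanFV by (auto simp: subspace_scale)
        have "c *s a + v \<in> span F"
          using v(1) by (rule span_add[OF span_scale[OF span_base[OF 1(1)]]])
        moreover have "(y - \<psi> v) - (\<psi> (c *s a) - c *s \<psi> a)
            - (\<psi> (c *s a + v) - (\<psi> (c *s a) + \<psi> v)) \<in> W'"
          by (intro subspace_diff[OF sub(3)] v(2) smult add aV)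
        then have "c *s x + y - \<psi> (c *s a + v) \<in> W'"
          using 1 by (simp add: algebra_simps)
        ultimately show ?thesis by blast
      next
        case 2
        then have "c *s x + (y - \<psi> v) \<in> W'"
          using D'(1) v(2) sub(3) by (meson subsetD subspace_add subspace_scale)
        then have "c *s x + y - \<psi> v \<in> W'"
          by (simp add: algebra_simps)
        then show ?thesis using v(1) by blast
      qed
    qed
    \<comment> \<open>Otherwise \<open>\<psi> e - \<psi> v\<close> lies in \<open>W'\<close> for some \<open>v\<close> in the span of \<open>F\<close>, so \<open>e - v\<close> lies in \<open>W\<close>,
      which contradicts the independence of \<open>E\<close>.\<close>
    have notin: "\<psi> e \<notin> span (\<psi> ` F \<union> D')"
    proof
      assume "\<psi> e \<in> span (\<psi> ` F \<union> D')"
      then obtain v where v: "v \<in> span F" "\<psi> e - \<psi> v \<in> W'"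
        using shape by blast
      have "v \<in> V"
        using v(1) spanFV by blast
      then have vV: "v \<in> V" "(-1) *s v \<in> V"
        by (simp_all only: subspace_scale[OF sub(1)])
      have "(\<psi> (e + (-1) *s v) - (\<psi> e + \<psi> ((-1) *s v)))
          + (\<psi> ((-1) *s v) - (-1) *s \<psi> v) + (\<psi> e - \<psi> v) \<in> W'"
        by (intro subspace_add[OF sub(3)] v(2) smult add vV eV)
      then have "\<psi> (e + (-1) *s v) \<in> W'"
        by (simp add: algebra_simps)
      then have "e + (-1) *s v \<in> W"
        using ker subspace_add[OF sub(1) eV(1) vV(2)] by blast
      then have "e - v \<in> span (E - {e})"
        using D(3) span_mono[of D "E - {e}"] E(1) eE by auto
      moreover have "v \<in> span (E - {e})"
        using v(1) span_mono[of F "E - {e}"] insert.hyps eE by auto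
      ultimately have "e \<in> span (E - {e})"
        using span_add[of "e - v" "E - {e}" v] by simp
      then show False
        using E(3) eE(1) dependent_def by blast
    qed
    then have "\<psi> e \<notin> \<psi> ` F \<union> D'"
      by (rule contrapos_nn) (rule span_base)
    moreover have IH: "independent (\<psi> ` F \<union> D')" "card (\<psi> ` F \<union> D') = card F + card D'"
      "\<psi> ` F \<union> D' \<subseteq> V'"
      using insert.IH eE(3) by auto
    moreover have "independent (insert (\<psi> e) (\<psi> ` F \<union> D'))"
      using notin IH(1) by (rule independent_insertI)
    ultimately show ?case
      using insert.hyps finD' maps[OF eV(1)] by auto
  qed
  from this[of "E - D"] have "card (E - D) + card D' \<le> dim V'"
    using independent_card_le_dim_finite_span[OF fin(2), of "\<psi> ` (E - D) \<union> D'"] by simp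
  moreover have "card (E - D) + card D = card E"
    using finE E(1) by (metis card_Diff_subset card_mono finite_subset le_add_diff_inverse2)
  ultimately show ?thesis
    using cardE D(4) D'(4) by linarith
qed


section \<open>Polynomials as a graded vector space\<close>

definition scalar_mult :: "'k \<Rightarrow> ('n::finite, 'k::field) mpoly \<Rightarrow> ('n, 'k) mpoly" where
  "scalar_mult c f = Poly_Mapping.single 0 c * f"

interpretation mpoly: vector_space "scalar_mult :: 'k::field \<Rightarrow> ('n::finite, 'k) mpoly \<Rightarrow> _"
  by unfold_locales
    (auto simp: scalar_mult_def algebra_simps single_add mult_single simp flip: mult.assoc)

lemma monomial_expansion:
  "f = (\<Sum>m\<in>Poly_Mapping.keys f. Poly_Mapping.single m (Poly_Mapping.lookup f m))"
  by (rule poly_mapping_eqI)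
    (auto simp: lookup_sum lookup_single when_def in_keys_iff)

lemma monomial_poly_expansion:
  "f = (\<Sum>m\<in>Poly_Mapping.keys f. scalar_mult (Poly_Mapping.lookup f m) (monomial_poly m))"
  by (subst monomial_expansion) (simp add: scalar_mult_def monomial_poly_def mult_single)

lemma lookup_single_mult_add:
  fixes f :: "('n::finite, 'k::field) mpoly"
  shows "Poly_Mapping.lookup (Poly_Mapping.single t c * f) (t + m) = c * Poly_Mapping.lookup f m"
proof -
  have "Poly_Mapping.single t c * f
      = (\<Sum>k\<in>Poly_Mapping.keys f. Poly_Mapping.single (t + k) (c * Poly_Mapping.lookup f k))"
    by (subst monomial_expansion[of f]) (simp add: sum_distrib_left mult_single)
  then show ?thesis
    by (auto simp: lookup_sum lookup_single when_def in_keys_iff)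
qed

lemma keys_single_mult:
  "Poly_Mapping.keys (Poly_Mapping.single t c * f) \<subseteq> (+) t ` Poly_Mapping.keys f"
  using keys_mult[of "Poly_Mapping.single t c" f] by (fastforce split: if_splits)

lemma lookup_scalar_mult [simp]:
  "Poly_Mapping.lookup (scalar_mult c f) m = c * Poly_Mapping.lookup f m"
  using lookup_single_mult_add[of 0 c f m] by (simp add: scalar_mult_def)

lemma mon_degree_add: "mon_degree (a + b) = mon_degree a + mon_degree b"
  by (simp add: mon_degree_def lookup_add sum.distrib)

lemma finite_mon_degree: "finite {m :: 'n::finite monomial. int (mon_degree m) = d}"
proof -
  have "Poly_Mapping.lookup m i \<le> mon_degree m" for m :: "'n monomial" and i
    unfolding mon_degree_def by (rule member_le_sum) auto
  then have "Poly_Mapping.lookup ` {m :: 'n monomial. int (mon_degree m) = d} \<subseteq> (UNIV \<rightarrow>\<^sub>E {..nat d})"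
    by (auto simp: PiE_def Pi_def)
  then have "finite (Poly_Mapping.lookup ` {m :: 'n monomial. int (mon_degree m) = d})"
    by (rule finite_subset) (simp add: finite_PiE)
  then show ?thesis
    by (rule finite_imageD) (simp add: inj_on_def poly_mapping.lookup_inject)
qed

lemma subspace_homogeneous_part: "mpoly.subspace (homogeneous_part d)"
  by (auto simp: mpoly.subspace_def homogeneous_part_def in_keys_iff lookup_add)

lemma finite_span_homogeneous_part:
  assumes "V \<subseteq> homogeneous_part d"
  shows "mpoly.finite_span (V :: ('n::finite, 'k::field) mpoly set)"
  unfolding mpoly.finite_span_def
proof (intro exI conjI subsetI)
  let ?F = "monomial_poly ` {m :: 'n monomial. int (mon_degree m) = d}
    :: ('n, 'k) mpoly set"
  show "finite ?F"
    by (intro finite_imageI finite_mon_degree)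
  fix f assume "f \<in> V"
  have "f = (\<Sum>m\<in>Poly_Mapping.keys f. scalar_mult (Poly_Mapping.lookup f m) (monomial_poly m))"
    by (rule monomial_poly_expansion)
  also have "\<dots> \<in> mpoly.span ?F"
    using \<open>f \<in> V\<close> assms
    by (intro mpoly.span_sum mpoly.span_scale mpoly.span_base) (auto simp: homogeneous_part_def)
  finally show "f \<in> mpoly.span ?F" .
qed

definition homogeneous_component :: "int \<Rightarrow> ('n::finite, 'k::field) mpoly \<Rightarrow> ('n, 'k) mpoly" where
  "homogeneous_component d = Poly_Mapping.mapp (\<lambda>m c. c when int (mon_degree m) = d)"

lemma lookup_homogeneous_component:
  "Poly_Mapping.lookup (homogeneous_component d f) m
     = (Poly_Mapping.lookup f m when int (mon_degree m) = d)"
  by (auto simp: homogeneous_component_def lookup_mapp when_def in_keys_iff)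

lemma homogeneous_component_in_part: "homogeneous_component d f \<in> homogeneous_part d"
  by (auto simp: homogeneous_part_def in_keys_iff lookup_homogeneous_component)

lemma homogeneous_component_single_mult:
  "homogeneous_component d (Poly_Mapping.single t c * f)
     = Poly_Mapping.single t c * homogeneous_component (d - int (mon_degree t)) f"
proof (rule poly_mapping_eqI)
  fix m
  show "Poly_Mapping.lookup (homogeneous_component d (Poly_Mapping.single t c * f)) m
    = Poly_Mapping.lookup (Poly_Mapping.single t c * homogeneous_component (d - int (mon_degree t)) f) m"
  proof (cases "m \<in> range ((+) t)")
    case True
    then obtain k where m: "m = t + k" by blast
    show ?thesis
      unfolding m lookup_homogeneous_component lookup_single_mult_add
      by (auto simp: when_def mon_degree_add)
  next
    case False
    then have "m \<notin> Poly_Mapping.keys (Poly_Mapping.single t c * g)" for g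
      using keys_single_mult by blast
    then show ?thesis
      by (simp add: lookup_homogeneous_component in_keys_iff)
  qed
qed


section \<open>Ideals of the polynomial ring\<close>

lemma mpoly_ring_simps [simp]:
  "carrier mpoly_ring = UNIV" "monoid.mult mpoly_ring = (*)" "ring.add mpoly_ring = (+)"
  "ring.zero mpoly_ring = 0" "monoid.one mpoly_ring = 1"
  by (auto simp: ring_of_type_algebra_def fun_eq_iff)

lemma ring_mpoly_ring: "ring mpoly_ring"
  by (rule ring_from_type_algebra)

lemma mpoly_idealD:
  assumes "ideal I mpoly_ring"
  shows "0 \<in> I" "f \<in> I \<Longrightarrow> g \<in> I \<Longrightarrow> f + g \<in> I" "f \<in> I \<Longrightarrow> r * f \<in> I"
  using additive_subgroup.zero_closed[OF ideal.axioms(1)[OF assms]]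
    additive_subgroup.a_closed[OF ideal.axioms(1)[OF assms], of f g]
    ideal.I_l_closed[OF assms, of f r]
  by auto

text \<open>Every polynomial is a sum of terms, so closure under multiplication by terms suffices.\<close>

lemma mpoly_idealI:
  fixes T :: "('n::finite, 'k::field) mpoly set"
  assumes "0 \<in> T" and add: "\<And>f g. f \<in> T \<Longrightarrow> g \<in> T \<Longrightarrow> f + g \<in> T"
    and mult: "\<And>t c f. f \<in> T \<Longrightarrow> Poly_Mapping.single t c * f \<in> T"
  shows "ideal T mpoly_ring"
proof -
  have sum: "(\<Sum>m\<in>M. h m) \<in> T" if "\<And>m. m \<in> M \<Longrightarrow> h m \<in> T" for M :: "'n monomial set" and h
    using that assms(1) by (induction M rule: infinite_finite_induct) (auto intro: add)
  have mult': "r * f \<in> T" if "f \<in> T" for r f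
  proof -
    have "r * f = (\<Sum>m\<in>Poly_Mapping.keys r. Poly_Mapping.single m (Poly_Mapping.lookup r m) * f)"
      by (subst monomial_expansion[of r]) (rule sum_distrib_right)
    also have "\<dots> \<in> T"
      using that by (intro sum mult)
    finally show ?thesis .
  qed
  interpret R: ring "mpoly_ring :: ('n, 'k) mpoly ring"
    by (rule ring_mpoly_ring)
  have neg: "\<ominus>\<^bsub>mpoly_ring\<^esub> f = - f" for f :: "('n, 'k) mpoly"
    by (rule R.minus_equality) auto
  show ?thesis
  proof (rule idealI[OF ring_mpoly_ring])
    show "subgroup T (add_monoid mpoly_ring)"
      using assms(1) add mult'[of _ "-1"] neg
      by (intro R.add.subgroupI) (auto simp: a_inv_def)
  qed (use mult' in \<open>auto simp: mult.commute\<close>)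
qed

lemma ideal_genideal_mpoly: "ideal (Idl\<^bsub>mpoly_ring\<^esub> S) mpoly_ring"
  by (rule ring.genideal_ideal[OF ring_mpoly_ring]) simp

lemma subspace_ideal:
  assumes "ideal I mpoly_ring"
  shows "mpoly.subspace I"
  using mpoly_idealD[OF assms] by (auto simp: mpoly.subspace_def scalar_mult_def)

lemma homogeneous_ideal_is_ideal:
  assumes "homogeneous_ideal I"
  shows "ideal I mpoly_ring"
  using assms ideal_genideal_mpoly unfolding homogeneous_ideal_def by blast

text \<open>The elements of \<open>I\<close> all of whose components lie in \<open>I\<close> form an ideal, because multiplying by a
  term only shifts the components. It contains the homogeneous generators, so it is all of \<open>I\<close>.\<close>

lemma homogeneous_component_mem_ideal:
  fixes I :: "('n::finite, 'k::field) mpoly set"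
  assumes "homogeneous_ideal I" "f \<in> I"
  shows "homogeneous_component d f \<in> I"
proof -
  obtain S where S: "S \<subseteq> (\<Union>d. homogeneous_part d)" "I = Idl\<^bsub>mpoly_ring\<^esub> S"
    using assms(1) homogeneous_ideal_def by blast
  note I = mpoly_idealD[OF homogeneous_ideal_is_ideal[OF assms(1)]]
  let ?T = "{f \<in> I. \<forall>d. homogeneous_component d f \<in> I}"
  have zero: "homogeneous_component d 0 = 0" for d
    by (rule poly_mapping_eqI) (simp add: lookup_homogeneous_component)
  have add: "homogeneous_component d (f + g) = homogeneous_component d f + homogeneous_component d g"
    for d and f g :: "('n, 'k) mpoly"
    by (rule poly_mapping_eqI) (simp add: lookup_homogeneous_component lookup_add when_add_distrib)
  have "ideal ?T mpoly_ring"
    by (rule mpoly_idealI) (auto simp: I zero add homogeneous_component_single_mult)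
  moreover have "S \<subseteq> ?T"
  proof
    fix s assume s: "s \<in> S"
    then obtain e where "s \<in> homogeneous_part e"
      using S(1) by blast
    then have "homogeneous_component d s = (if d = e then s else 0)" for d
      by (intro poly_mapping_eqI)
        (auto simp: lookup_homogeneous_component homogeneous_part_def in_keys_iff when_def)
    moreover have "s \<in> I"
      using ring.genideal_self[OF ring_mpoly_ring] s S(2) by auto
    ultimately show "s \<in> ?T"
      using I(1) by auto
  qed
  ultimately have "I \<subseteq> ?T"
    using ring.genideal_minimal[OF ring_mpoly_ring] S(2) by blast
  then show ?thesis
    using assms(2) by blast
qed


section \<open>Leading monomials and the dimension of the initial ideal\<close>

lemma term_orderD:
  assumes "term_order \<sigma>"
  shows "(a, a) \<in> \<sigma>" "(a, b) \<in> \<sigma> \<Longrightarrow> (b, c) \<in> \<sigma> \<Longrightarrow> (a, c) \<in> \<sigma>"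
    "(a, b) \<in> \<sigma> \<Longrightarrow> (b, a) \<in> \<sigma> \<Longrightarrow> a = b" "(a, b) \<in> \<sigma> \<or> (b, a) \<in> \<sigma>"
    "(a, b) \<in> \<sigma> \<Longrightarrow> (t + a, t + b) \<in> \<sigma>"
  using assms
  unfolding term_order_def order_on_defs refl_on_def trans_def antisym_def total_on_def
  by (blast, blast, blast, metis UNIV_I, metis add.commute)

lemma finite_has_term_order_max:
  assumes \<sigma>: "term_order \<sigma>" and "finite M" "M \<noteq> {}"
  shows "\<exists>m\<in>M. \<forall>k\<in>M. (k, m) \<in> \<sigma>"
  using assms(2,3)
proof (induction M rule: finite_ne_induct)
  case (singleton x)
  then show ?case using term_orderD[OF \<sigma>] by blast
next
  case (insert x F)
  then show ?case using term_orderD[OF \<sigma>] by (metis insert_iff)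
qed

lemma leading_monomial_eqI:
  assumes \<sigma>: "term_order \<sigma>"
    and "m \<in> Poly_Mapping.keys f" "\<And>k. k \<in> Poly_Mapping.keys f \<Longrightarrow> (k, m) \<in> \<sigma>"
  shows "leading_monomial \<sigma> f = m"
  unfolding leading_monomial_def
  by (rule the_equality) (use assms term_orderD(3)[OF \<sigma>] in blast)+

lemma leading_monomial_props:
  assumes \<sigma>: "term_order \<sigma>" and "f \<noteq> 0"
  shows "leading_monomial \<sigma> f \<in> Poly_Mapping.keys f"
    and "k \<in> Poly_Mapping.keys f \<Longrightarrow> (k, leading_monomial \<sigma> f) \<in> \<sigma>"
proof -
  obtain m where "m \<in> Poly_Mapping.keys f" "\<forall>k\<in>Poly_Mapping.keys f. (k, m) \<in> \<sigma>"
    using finite_has_term_order_max[OF \<sigma>, of "Poly_Mapping.keys f"] assms(2) by auto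
  then show "leading_monomial \<sigma> f \<in> Poly_Mapping.keys f"
    and "k \<in> Poly_Mapping.keys f \<Longrightarrow> (k, leading_monomial \<sigma> f) \<in> \<sigma>"
    using leading_monomial_eqI[OF \<sigma>] by auto
qed

definition leading_monomials ::
  "'n::finite monomial rel \<Rightarrow> ('n, 'k::field) mpoly set \<Rightarrow> 'n monomial set" where
  "leading_monomials \<sigma> V = {leading_monomial \<sigma> f |f. f \<in> V \<and> f \<noteq> 0}"

text \<open>Choose one element of \<open>V\<close> for each leading monomial. These elements are independent, because the
  largest leading monomial with a nonzero coefficient cannot cancel in a linear combination. They
  span \<open>V\<close>, because subtracting a multiple of one of them lowers the leading monomial, and \<open>T\<close> offers
  only finitely many.\<close>

lemma dim_eq_card_leading_monomials:
  fixes V :: "('n::finite, 'k::field) mpoly set"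
  assumes \<sigma>: "term_order \<sigma>" and V: "mpoly.subspace V"
    and T: "finite T" "\<And>f. f \<in> V \<Longrightarrow> Poly_Mapping.keys f \<subseteq> T"
  shows "mpoly.dim V = card (leading_monomials \<sigma> V)"
proof -
  let ?L = "leading_monomials \<sigma> V"
  note lm = leading_monomial_props[OF \<sigma>]
  have "\<forall>m\<in>?L. \<exists>g. g \<in> V \<and> g \<noteq> 0 \<and> leading_monomial \<sigma> g = m"
    by (auto simp: leading_monomials_def)
  then obtain g where g: "\<And>m. m \<in> ?L \<Longrightarrow> g m \<in> V" "\<And>m. m \<in> ?L \<Longrightarrow> g m \<noteq> 0"
    "\<And>m. m \<in> ?L \<Longrightarrow> leading_monomial \<sigma> (g m) = m"
    by metis
  have inj: "inj_on g ?L"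
    using g(3) by (rule inj_on_inverseI)
  have "?L \<subseteq> T"
    using T(2) lm(1) by (fastforce simp: leading_monomials_def)
  then have finL: "finite ?L"
    using T(1) finite_subset by blast
  have lead_nz: "Poly_Mapping.lookup (g m) m \<noteq> 0" if "m \<in> ?L" for m
    using lm(1)[OF g(2)[OF that]] g(3)[OF that] by (simp add: in_keys_iff)
  have "mpoly.independent (g ` ?L)"
  proof
    assume "mpoly.dependent (g ` ?L)"
    then obtain u where u: "\<exists>v\<in>g ` ?L. u v \<noteq> 0" "(\<Sum>v\<in>g ` ?L. scalar_mult (u v) v) = 0"
      using finL by (auto simp: mpoly.dependent_finite)
    let ?M = "{m \<in> ?L. u (g m) \<noteq> 0}"
    have "finite ?M" "?M \<noteq> {}"
      using finL u(1) by auto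
    then obtain m where m: "m \<in> ?L" "u (g m) \<noteq> 0" "\<And>k. k \<in> ?M \<Longrightarrow> (k, m) \<in> \<sigma>"
      using finite_has_term_order_max[OF \<sigma>, of ?M] by blast
    \<comment> \<open>The coefficient of the combination at the maximal \<open>m\<close> comes from \<open>g m\<close> alone.\<close>
    have vanish: "u (g k) * Poly_Mapping.lookup (g k) m = 0" if "k \<in> ?L" "k \<noteq> m" for k
    proof (rule ccontr)
      assume *: "u (g k) * Poly_Mapping.lookup (g k) m \<noteq> 0"
      then have "(k, m) \<in> \<sigma>" "(m, k) \<in> \<sigma>"
        using m(3)[of k] lm(2)[OF g(2)[OF that(1)], of m] g(3)[OF that(1)] that(1)
        by (auto simp: in_keys_iff)
      then show False
        using term_orderD(3)[OF \<sigma>] that(2) by blast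
    qed
    have "0 = (\<Sum>k\<in>?L. u (g k) * Poly_Mapping.lookup (g k) m)"
      using arg_cong[OF u(2), of "\<lambda>f. Poly_Mapping.lookup f m"]
      by (simp add: lookup_sum sum.reindex[OF inj])
    also have "\<dots> = u (g m) * Poly_Mapping.lookup (g m) m"
      by (subst sum.mono_neutral_right[OF finL, of "{m}"]) (use m(1) vanish in auto)
    finally show False
      using m(2) lead_nz[OF m(1)] by simp
  qed
  moreover have "V \<subseteq> mpoly.span (g ` ?L)"
  proof
    fix f assume "f \<in> V"
    then show "f \<in> mpoly.span (g ` ?L)"
    proof (induction "card {k \<in> T. (k, leading_monomial \<sigma> f) \<in> \<sigma>}" arbitrary: f rule: less_induct)
      case less
      show ?case
      proof (cases "f = 0")
        case True
        then show ?thesis by (simp add: mpoly.span_zero)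
      next
        case False
        define m where "m = leading_monomial \<sigma> f"
        define c where "c = Poly_Mapping.lookup f m / Poly_Mapping.lookup (g m) m"
        define f' where "f' = f - scalar_mult c (g m)"
        have mL: "m \<in> ?L"
          using less.prems False by (auto simp: m_def leading_monomials_def)
        have gm: "scalar_mult c (g m) \<in> mpoly.span (g ` ?L)"
          using mL by (intro mpoly.span_scale mpoly.span_base) auto
        have f'V: "f' \<in> V"
          unfolding f'_def using V less.prems g(1)[OF mL]
          by (intro mpoly.subspace_diff mpoly.subspace_scale)
        have cancel: "Poly_Mapping.lookup f' m = 0"
          using lead_nz[OF mL] by (simp add: f'_def lookup_minus c_def)
        have "f' \<in> mpoly.span (g ` ?L)"
        proof (cases "f' = 0")
          case True
          then show ?thesis by (simp add: mpoly.span_zero)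
        next
          case f': False
          define m' where "m' = leading_monomial \<sigma> f'"
          have m': "m' \<in> Poly_Mapping.keys f'"
            using lm(1)[OF f'] by (simp add: m'_def)
          have "m' \<noteq> m"
            using m' cancel by (auto simp: in_keys_iff)
          have "m' \<in> Poly_Mapping.keys f \<union> Poly_Mapping.keys (g m)"
            using m' by (auto simp: f'_def in_keys_iff lookup_minus)
          then have "(m', m) \<in> \<sigma>"
            using lm(2)[OF False] lm(2)[OF g(2)[OF mL]] g(3)[OF mL] by (auto simp: m_def)
          have "m \<in> T"
            using mL \<open>?L \<subseteq> T\<close> by blast
          have "{k \<in> T. (k, m') \<in> \<sigma>} \<subseteq> {k \<in> T. (k, m) \<in> \<sigma>}"
            using \<open>(m', m) \<in> \<sigma>\<close> term_orderD(2)[OF \<sigma>] by blast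
          moreover have "m \<notin> {k \<in> T. (k, m') \<in> \<sigma>}" "m \<in> {k \<in> T. (k, m) \<in> \<sigma>}"
            using \<open>(m', m) \<in> \<sigma>\<close> \<open>m' \<noteq> m\<close> \<open>m \<in> T\<close> term_orderD(1,3)[OF \<sigma>] by auto
          ultimately have "card {k \<in> T. (k, m') \<in> \<sigma>} < card {k \<in> T. (k, m) \<in> \<sigma>}"
            using T(1) by (intro psubset_card_mono) auto
          then show ?thesis
            using less.hyps[OF _ f'V] by (simp add: m_def m'_def)
        qed
        then have "f' + scalar_mult c (g m) \<in> mpoly.span (g ` ?L)"
          using gm by (rule mpoly.span_add)
        then show ?thesis
          by (simp add: f'_def)
      qed
    qed
  qed
  moreover have "g ` ?L \<subseteq> V"
    using g(1) by blast
  ultimately have "mpoly.dim V = card (g ` ?L)"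
    using mpoly.basis_card_eq_dim by metis
  then show ?thesis
    using card_image[OF inj] by simp
qed

lemma leading_monomials_ideal_add_closed:
  assumes \<sigma>: "term_order \<sigma>" and I: "ideal I mpoly_ring" and "m \<in> leading_monomials \<sigma> I"
  shows "t + m \<in> leading_monomials \<sigma> I"
proof -
  obtain f where f: "f \<in> I" "f \<noteq> 0" "m = leading_monomial \<sigma> f"
    using assms(3) by (auto simp: leading_monomials_def)
  note lm = leading_monomial_props[OF \<sigma> f(2), folded f(3)]
  let ?h = "Poly_Mapping.single t 1 * f"
  have key: "t + m \<in> Poly_Mapping.keys ?h"
    using lm(1) by (simp add: in_keys_iff lookup_single_mult_add)
  have "leading_monomial \<sigma> ?h = t + m"
    using keys_single_mult[of t 1 f] lm(2) term_orderD(5)[OF \<sigma>]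
    by (intro leading_monomial_eqI[OF \<sigma> key]) blast
  moreover have "?h \<in> I" "?h \<noteq> 0"
    using mpoly_idealD(3)[OF I f(1)] key by auto
  ultimately show ?thesis
    unfolding leading_monomials_def mem_Collect_eq by (intro exI[of _ ?h]) simp
qed

text \<open>The leading monomials of an ideal are closed under multiplication by monomials, so the
  monomial ideal that they generate contains no further monomials.\<close>

lemma initial_ideal_eq:
  fixes I :: "('n::finite, 'k::field) mpoly set"
  assumes \<sigma>: "term_order \<sigma>" and I: "ideal I mpoly_ring"
  shows "initial_ideal \<sigma> I = {f. Poly_Mapping.keys f \<subseteq> leading_monomials \<sigma> I}"
proof
  let ?G = "{monomial_poly (leading_monomial \<sigma> f) |f. f \<in> I \<and> f \<noteq> 0} :: ('n, 'k) mpoly set"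
  let ?T = "{f. Poly_Mapping.keys f \<subseteq> leading_monomials \<sigma> I} :: ('n, 'k) mpoly set"
  have "ideal ?T mpoly_ring"
  proof (rule mpoly_idealI)
    fix f g assume "f \<in> ?T" "g \<in> ?T"
    then show "f + g \<in> ?T" using keys_add[of f g] by blast
  next
    fix t c f assume "f \<in> ?T"
    then show "Poly_Mapping.single t c * f \<in> ?T"
      using keys_single_mult[of t c f] leading_monomials_ideal_add_closed[OF \<sigma> I] by blast
  qed simp
  moreover have "?G \<subseteq> ?T"
    by (auto simp: monomial_poly_def leading_monomials_def)
  ultimately show "initial_ideal \<sigma> I \<subseteq> ?T"
    unfolding initial_ideal_def by (rule ring.genideal_minimal[OF ring_mpoly_ring])
  have G: "?G \<subseteq> initial_ideal \<sigma> I"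
    unfolding initial_ideal_def by (rule ring.genideal_self[OF ring_mpoly_ring]) simp
  have in_id: "ideal (initial_ideal \<sigma> I) mpoly_ring"
    unfolding initial_ideal_def by (rule ideal_genideal_mpoly)
  show "?T \<subseteq> initial_ideal \<sigma> I"
  proof
    fix f assume f: "f \<in> ?T"
    have "f = (\<Sum>m\<in>Poly_Mapping.keys f. scalar_mult (Poly_Mapping.lookup f m) (monomial_poly m))"
      by (rule monomial_poly_expansion)
    also have "\<dots> \<in> initial_ideal \<sigma> I"
      using f G by (intro mpoly.subspace_sum mpoly.subspace_scale subspace_ideal in_id)
        (auto simp: leading_monomials_def)
    finally show "f \<in> initial_ideal \<sigma> I" .
  qed
qed

text \<open>If \<open>f \<in> I\<close> has a leading monomial of degree \<open>d\<close>, then the component of \<open>f\<close> of degree \<open>d\<close> has the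
  same leading monomial and lies in \<open>I\<close>, even if \<open>\<sigma>\<close> does not refine the degree.\<close>

lemma leading_monomials_initial_ideal_part:
  fixes I :: "('n::finite, 'k::field) mpoly set"
  assumes \<sigma>: "term_order \<sigma>" and I: "homogeneous_ideal I"
  shows "leading_monomials \<sigma> (initial_ideal \<sigma> I \<inter> homogeneous_part d)
    = leading_monomials \<sigma> (I \<inter> homogeneous_part d)"
proof (intro equalityI subsetI)
  note in_eq = initial_ideal_eq[OF \<sigma> homogeneous_ideal_is_ideal[OF I]]
  note lm = leading_monomial_props[OF \<sigma>]
  fix m
  {
    assume "m \<in> leading_monomials \<sigma> (initial_ideal \<sigma> I \<inter> homogeneous_part d)"
    then obtain h where h: "h \<in> initial_ideal \<sigma> I" "h \<in> homogeneous_part d" "m \<in> Poly_Mapping.keys h"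
      using lm(1) by (auto simp: leading_monomials_def)
    then have deg: "int (mon_degree m) = d" and "m \<in> leading_monomials \<sigma> I"
      by (auto simp: in_eq homogeneous_part_def)
    then obtain f where f: "f \<in> I" "f \<noteq> 0" "m = leading_monomial \<sigma> f"
      by (auto simp: leading_monomials_def)
    let ?f = "homogeneous_component d f"
    have key: "m \<in> Poly_Mapping.keys ?f"
      using lm(1)[OF f(2)] deg by (simp add: f(3) in_keys_iff lookup_homogeneous_component)
    moreover have "leading_monomial \<sigma> ?f = m"
      using lm(2)[OF f(2)]
      by (intro leading_monomial_eqI[OF \<sigma> key])
        (auto simp: f(3) in_keys_iff lookup_homogeneous_component when_def split: if_splits)
    ultimately show "m \<in> leading_monomials \<sigma> (I \<inter> homogeneous_part d)"
      using homogeneous_component_mem_ideal[OF I f(1)] homogeneous_component_in_part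
      unfolding leading_monomials_def by fastforce
  next
    assume "m \<in> leading_monomials \<sigma> (I \<inter> homogeneous_part d)"
    then obtain f where f: "f \<in> I" "f \<in> homogeneous_part d" "f \<noteq> 0" "m = leading_monomial \<sigma> f"
      by (auto simp: leading_monomials_def)
    let ?h = "monomial_poly m :: ('n, 'k) mpoly"
    have keys: "Poly_Mapping.keys ?h = {m}"
      by (simp add: monomial_poly_def)
    have "?h \<in> initial_ideal \<sigma> I"
      using f unfolding in_eq keys leading_monomials_def mem_Collect_eq by blast
    moreover have "?h \<in> homogeneous_part d"
      using f(2) lm(1)[OF f(3)] 
      unfolding homogeneous_part_def mem_Collect_eq keys f(4)[symmetric] by blast
    moreover have "?h \<noteq> 0" "leading_monomial \<sigma> ?h = m"
      using keys term_orderD(1)[OF \<sigma>] by (auto intro!: leading_monomial_eqI[OF \<sigma>])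
    ultimately show "m \<in> leading_monomials \<sigma> (initial_ideal \<sigma> I \<inter> homogeneous_part d)"
      unfolding leading_monomials_def mem_Collect_eq by (intro exI[of _ ?h]) simp
  }
qed

text \<open>Macaulay's theorem: a homogeneous ideal and its initial ideal have the same Hilbert function.\<close>

lemma dim_initial_ideal_part:
  fixes I :: "('n::finite, 'k::field) mpoly set"
  assumes \<sigma>: "term_order \<sigma>" and I: "homogeneous_ideal I"
  shows "mpoly.dim (initial_ideal \<sigma> I \<inter> homogeneous_part d) = mpoly.dim (I \<inter> homogeneous_part d)"
proof -
  have "mpoly.dim (I' \<inter> homogeneous_part d)
      = card (leading_monomials \<sigma> (I' \<inter> homogeneous_part d))"
    if "ideal I' mpoly_ring" for I' :: "('n, 'k) mpoly set"
    using that
    by (intro dim_eq_card_leading_monomials[OF \<sigma> _ finite_mon_degree[of d]]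
          mpoly.subspace_inter subspace_ideal subspace_homogeneous_part)
      (auto simp: homogeneous_part_def)
  from this[OF homogeneous_ideal_is_ideal[OF I]] this[of "initial_ideal \<sigma> I"] show ?thesis
    using leading_monomials_initial_ideal_part[OF assms]
    by (simp add: initial_ideal_def ideal_genideal_mpoly)
qed


section \<open>Dimension inequalities from biliaisons and Basic Double Links\<close>

text \<open>The degree-\<open>d\<close> part of a homomorphism \<open>V/W \<rightarrow> V'/W'\<close> that shifts degrees by \<open>e - d\<close> and is
  injective on that part.\<close>

lemma dim_ideal_quotient_mono:
  fixes V W V' W' :: "('n::finite, 'k::field) mpoly set"
  assumes "ideal V mpoly_ring" "ideal W mpoly_ring" "ideal W' mpoly_ring"
    and "W \<subseteq> V" "W' \<subseteq> V'"
    and "\<And>v. v \<in> V \<inter> homogeneous_part d \<Longrightarrow> \<psi> v \<in> V' \<inter> homogeneous_part e"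
    and "\<And>v w. v \<in> V \<inter> homogeneous_part d \<Longrightarrow> w \<in> V \<inter> homogeneous_part d
      \<Longrightarrow> \<psi> (v + w) - (\<psi> v + \<psi> w) \<in> W'"
    and "\<And>c v. v \<in> V \<inter> homogeneous_part d \<Longrightarrow> \<psi> (scalar_mult c v) - scalar_mult c (\<psi> v) \<in> W'"
    and "\<And>v. v \<in> V \<inter> homogeneous_part d \<Longrightarrow> \<psi> v \<in> W' \<Longrightarrow> v \<in> W"
  shows "mpoly.dim (V \<inter> homogeneous_part d) + mpoly.dim (W' \<inter> homogeneous_part e)
    \<le> mpoly.dim (V' \<inter> homogeneous_part e) + mpoly.dim (W \<inter> homogeneous_part d)"
proof -
  note sub = mpoly.subspace_inter[OF subspace_ideal subspace_homogeneous_part]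
  have add: "v + w \<in> V \<inter> homogeneous_part d"
    if "v \<in> V \<inter> homogeneous_part d" "w \<in> V \<inter> homogeneous_part d" for v w
    using mpoly.subspace_add[OF sub[OF assms(1)]] that by blast
  have scale: "scalar_mult c v \<in> V \<inter> homogeneous_part d" if "v \<in> V \<inter> homogeneous_part d" for c v
    using mpoly.subspace_scale[OF sub[OF assms(1)]] that by blast
  note hom = mpoly.subspace_diff[OF subspace_homogeneous_part]
    mpoly.subspace_add[OF subspace_homogeneous_part]
    mpoly.subspace_scale[OF subspace_homogeneous_part]
  show ?thesis
  proof (rule mpoly.dim_quotient_mono[where \<psi> = \<psi>])
    fix v w assume vw: "v \<in> V \<inter> homogeneous_part d" "w \<in> V \<inter> homogeneous_part d"
    show "\<psi> (v + w) - (\<psi> v + \<psi> w) \<in> W' \<inter> homogeneous_part e"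
      using assms(6)[OF vw(1)] assms(6)[OF vw(2)] assms(6)[OF add[OF vw]] assms(7)[OF vw]
      by (metis IntE IntI hom(1,2))
  next
    fix c v assume v: "v \<in> V \<inter> homogeneous_part d"
    show "\<psi> (scalar_mult c v) - scalar_mult c (\<psi> v) \<in> W' \<inter> homogeneous_part e"
      using assms(6)[OF v] assms(6)[OF scale[OF v]] assms(8)[OF v] by (metis IntE IntI hom(1,3))
  qed (use assms sub in \<open>auto intro: finite_span_homogeneous_part\<close>)
qed

lemma coset_eq_iff:
  fixes N :: "('n::finite, 'k::field) mpoly set"
  assumes "ideal N mpoly_ring"
  shows "N +>\<^bsub>mpoly_ring\<^esub> f = N +>\<^bsub>mpoly_ring\<^esub> g \<longleftrightarrow> f - g \<in> N"
proof -
  have coset: "N +>\<^bsub>mpoly_ring\<^esub> h = {n + h |n. n \<in> N}" for h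
    by (auto simp: a_r_coset_def r_coset_def)
  note sub = subspace_ideal[OF assms]
  show ?thesis
  proof
    assume "N +>\<^bsub>mpoly_ring\<^esub> f = N +>\<^bsub>mpoly_ring\<^esub> g"
    moreover have "f \<in> N +>\<^bsub>mpoly_ring\<^esub> f"
      using mpoly_idealD(1)[OF assms] unfolding coset by force
    ultimately show "f - g \<in> N"
      unfolding coset by auto
  next
    assume *: "f - g \<in> N"
    have "n + f = (n + (f - g)) + g" "n + g = (n - (f - g)) + f" for n
      by simp_all
    then show "N +>\<^bsub>mpoly_ring\<^esub> f = N +>\<^bsub>mpoly_ring\<^esub> g"
      unfolding coset
      using * mpoly.subspace_add[OF sub] mpoly.subspace_diff[OF sub] by blast
  qed
qed

text \<open>The isomorphism \<open>J/N \<cong> [I/N](-l)\<close> sends the class of \<open>f \<in> J\<^sub>d\<close> to the class of some element of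
  \<open>I\<^bsub>d-l\<^esub>\<close>; choosing such elements gives \<open>\<psi>\<close>. Scalars act through the classes of the constants in
  \<open>R/N\<close>, so \<open>R/N\<close>-linearity makes \<open>\<psi>\<close> linear over the field modulo \<open>N\<close>.\<close>

lemma biliaison_dim_le:
  fixes I J N :: "('n::finite, 'k::field) mpoly set"
  assumes I: "ideal I mpoly_ring" and J: "ideal J mpoly_ring" and N: "ideal N mpoly_ring"
    and "N \<subseteq> I \<inter> J"
    and iso: "graded_module_iso (mpoly_ring Quot N) (ideal_quotient J N)
      (degree_shift (ideal_quotient I N) (- l))"
  shows "mpoly.dim (J \<inter> homogeneous_part d) + mpoly.dim (N \<inter> homogeneous_part (d - l))
    \<le> mpoly.dim (I \<inter> homogeneous_part (d - l)) + mpoly.dim (N \<inter> homogeneous_part d)"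
proof -
  define cl where "cl f = N +>\<^bsub>mpoly_ring\<^esub> f" for f
  note cl_eq = coset_eq_iff[OF N, folded cl_def]
  have cl_add: "cl f <+>\<^bsub>mpoly_ring\<^esub> cl g = cl (f + g)" for f g
    using abelian_subgroup.a_rcos_sum[OF abelian_subgroupI3[OF ideal.axioms(1)[OF N]], of f g]
      ring.is_abelian_group[OF ring_mpoly_ring] by (simp add: cl_def)
  have cl_smult: "rcoset_mult mpoly_ring N (cl (Poly_Mapping.single 0 c)) (cl f) = cl (scalar_mult c f)"
    for c f
    using ideal.rcoset_mult_add[OF N, of "Poly_Mapping.single 0 c" f]
    by (simp add: cl_def scalar_mult_def)
  have cl_carrier: "cl f \<in> carrier (mpoly_ring Quot N)" for f
    by (auto simp: cl_def FactRing_def A_RCOSETS_def RCOSETS_def a_r_coset_def)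
  obtain \<phi> where inj: "inj_on \<phi> (cl ` J)"
    and add: "\<And>f g. f \<in> J \<Longrightarrow> g \<in> J \<Longrightarrow> \<phi> (cl (f + g)) = \<phi> (cl f) <+>\<^bsub>mpoly_ring\<^esub> \<phi> (cl g)"
    and smult': "\<And>a f. a \<in> carrier (mpoly_ring Quot N) \<Longrightarrow> f \<in> J
      \<Longrightarrow> \<phi> (rcoset_mult mpoly_ring N a (cl f)) = rcoset_mult mpoly_ring N a (\<phi> (cl f))"
    and comp: "\<phi> ` cl ` (J \<inter> homogeneous_part d) = cl ` (I \<inter> homogeneous_part (d - l))"
    using iso
    unfolding graded_module_iso_def ideal_quotient_def degree_shift_def bij_betw_def
    by (auto simp: FactRing_def cl_add simp flip: cl_def)
  have smult: "\<phi> (cl (scalar_mult c f))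
      = rcoset_mult mpoly_ring N (cl (Poly_Mapping.single 0 c)) (\<phi> (cl f))" if "f \<in> J" for c f
    using smult'[OF cl_carrier that, of "Poly_Mapping.single 0 c"] by (simp only: cl_smult)
  have "\<exists>g. g \<in> I \<inter> homogeneous_part (d - l) \<and> \<phi> (cl f) = cl g"
    if "f \<in> J \<inter> homogeneous_part d" for f
    using comp that by blast
  then obtain \<psi> where \<psi>: "\<And>f. f \<in> J \<inter> homogeneous_part d \<Longrightarrow> \<psi> f \<in> I \<inter> homogeneous_part (d - l)"
    "\<And>f. f \<in> J \<inter> homogeneous_part d \<Longrightarrow> \<phi> (cl f) = cl (\<psi> f)"
    by metis
  note sub = mpoly.subspace_inter[OF subspace_ideal[OF J] subspace_homogeneous_part]
  show ?thesis
  proof (rule dim_ideal_quotient_mono[OF J N N, where \<psi> = \<psi>])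
    fix v w assume vw: "v \<in> J \<inter> homogeneous_part d" "w \<in> J \<inter> homogeneous_part d"
    have "cl (\<psi> (v + w)) = cl (\<psi> v + \<psi> w)"
      using add[of v w] vw \<psi>(2) mpoly.subspace_add[OF sub vw] by (simp add: cl_add)
    then show "\<psi> (v + w) - (\<psi> v + \<psi> w) \<in> N"
      by (simp add: cl_eq)
  next
    fix c v assume v: "v \<in> J \<inter> homogeneous_part d"
    have "cl (\<psi> (scalar_mult c v)) = cl (scalar_mult c (\<psi> v))"
      using smult[of v c] v \<psi>(2) mpoly.subspace_scale[OF sub v] by (simp add: cl_smult)
    then show "\<psi> (scalar_mult c v) - scalar_mult c (\<psi> v) \<in> N"
      by (simp add: cl_eq)
  next
    fix v assume v: "v \<in> J \<inter> homogeneous_part d" "\<psi> v \<in> N"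
    have zero: "0 \<in> J \<inter> homogeneous_part d"
      using sub by (rule mpoly.subspace_0)
    \<comment> \<open>Linearity with the scalar \<open>0\<close> shows that \<open>\<phi>\<close> preserves the class of \<open>0\<close>.\<close>
    have "\<phi> (cl (scalar_mult 0 0)) = cl (scalar_mult 0 (\<psi> 0))"
      using smult[of 0 0] zero unfolding \<psi>(2)[OF zero] cl_smult by blast
    then have "\<phi> (cl 0) = cl 0"
      by simp
    also have "\<dots> = \<phi> (cl v)"
      using v(2) \<psi>(2)[OF v(1)] cl_eq[of "\<psi> v" 0] by simp
    finally have "cl v = cl 0"
      using inj v(1) zero by (metis IntD1 imageI inj_onD)
    then show "v \<in> N"
      by (simp add: cl_eq)
  qed (use assms(4) \<psi>(1) in auto)
qed

lemma homogeneous_part_mult: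
  assumes "f \<in> homogeneous_part d" "g \<in> homogeneous_part e"
  shows "f * g \<in> homogeneous_part (d + e)"
  using assms keys_mult[of f g] by (fastforce simp: homogeneous_part_def mon_degree_add)

text \<open>Multiplication by \<open>f\<close> maps \<open>B\<close> into \<open>C = A + fB\<close> and raises degrees by \<open>l\<close>; it is injective
  modulo \<open>A\<close> because \<open>A : f = A\<close>.\<close>

lemma basic_double_link_dim_le:
  fixes A B C :: "('n::finite, 'k::field) mpoly set"
  assumes "basic_double_link C B A l"
  shows "mpoly.dim (B \<inter> homogeneous_part (d - l)) + mpoly.dim (A \<inter> homogeneous_part d)
    \<le> mpoly.dim (C \<inter> homogeneous_part d) + mpoly.dim (A \<inter> homogeneous_part (d - l))"
proof -
  obtain f where f: "f \<in> homogeneous_part l" "{r. r * f \<in> A} = A"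
    "C = {a + f * b |a b. a \<in> A \<and> b \<in> B}"
    and A: "ideal A mpoly_ring" and B: "ideal B mpoly_ring" and "A \<subseteq> B"
    using assms homogeneous_ideal_is_ideal unfolding basic_double_link_def by blast
  note A0 = mpoly_idealD(1)[OF A] and B0 = mpoly_idealD(1)[OF B]
  show ?thesis
  proof (rule dim_ideal_quotient_mono[OF B A A, where \<psi> = "(*) f"])
    show "A \<subseteq> C"
    proof
      fix a assume "a \<in> A"
      moreover have "a = a + f * 0" by simp
      ultimately show "a \<in> C" using f(3) B0 by blast
    qed
    fix v assume v: "v \<in> B \<inter> homogeneous_part (d - l)"
    have "f * v = 0 + f * v" by simp
    then have "f * v \<in> C" using f(3) A0 v by blast
    then show "f * v \<in> C \<inter> homogeneous_part d"
      using homogeneous_part_mult[OF f(1), of v "d - l"] v by simp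
  qed (use \<open>A \<subseteq> B\<close> A0 f(2) in \<open>auto simp: algebra_simps scalar_mult_def\<close>)
qed

section \<open>Initial ideals of biliaisons\<close>

theorem lemma1p12:
  fixes I J N A B C :: "('n::finite, 'k::field) mpoly set"
    and \<sigma> :: "'n monomial rel" and l :: int
  assumes "homogeneous_ideal I" "saturated I" "unmixed mpoly_ring I"
    and "homogeneous_ideal J" "saturated J" "unmixed mpoly_ring J"
    and "homogeneous_ideal N" "saturated N" "unmixed mpoly_ring N"
    and "N \<subseteq> I \<inter> J"
    and "height mpoly_ring I = height mpoly_ring J"
    and "height mpoly_ring J = height mpoly_ring N + 1"
    and "cohen_macaulay_ideal mpoly_ring N"
    and "term_order \<sigma>"
    and "monomial_ideal A" "monomial_ideal B" "monomial_ideal C"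
    and "C \<subseteq> initial_ideal \<sigma> J"
    and "A = initial_ideal \<sigma> N"
    and "B = initial_ideal \<sigma> I"
    and "cohen_macaulay_ideal mpoly_ring A"
    and "height mpoly_ring B = height mpoly_ring A + 1"
    and "elementary_biliaison I J N l"
    and "basic_double_link C B A l"
  shows "C = initial_ideal \<sigma> J"
proof
  note \<sigma> = \<open>term_order \<sigma>\<close>
  note dim_in = dim_initial_ideal_part[OF \<sigma>]
  have C: "ideal C mpoly_ring"
    using \<open>monomial_ideal C\<close> ideal_genideal_mpoly unfolding monomial_ideal_def by blast
  note in_eq = initial_ideal_eq[OF \<sigma> homogeneous_ideal_is_ideal[OF \<open>homogeneous_ideal J\<close>]]
  have parts: "C \<inter> homogeneous_part d = initial_ideal \<sigma> J \<inter> homogeneous_part d" for d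
  proof (rule mpoly.subspace_eq_of_dim_le)
    have "mpoly.dim (J \<inter> homogeneous_part d) + mpoly.dim (N \<inter> homogeneous_part (d - l))
        \<le> mpoly.dim (I \<inter> homogeneous_part (d - l)) + mpoly.dim (N \<inter> homogeneous_part d)"
      using \<open>elementary_biliaison I J N l\<close> \<open>homogeneous_ideal N\<close> homogeneous_ideal_is_ideal
      by (intro biliaison_dim_le) (auto simp: elementary_biliaison_def)
    moreover have "mpoly.dim (I \<inter> homogeneous_part (d - l)) + mpoly.dim (N \<inter> homogeneous_part d)
        \<le> mpoly.dim (C \<inter> homogeneous_part d) + mpoly.dim (N \<inter> homogeneous_part (d - l))"
      using basic_double_link_dim_le[OF \<open>basic_double_link C B A l\<close>, of d]
        dim_in[OF \<open>homogeneous_ideal I\<close>] dim_in[OF \<open>homogeneous_ideal N\<close>]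
      by (simp add: \<open>A = initial_ideal \<sigma> N\<close> \<open>B = initial_ideal \<sigma> I\<close>)
    ultimately show "mpoly.dim (initial_ideal \<sigma> J \<inter> homogeneous_part d)
        \<le> mpoly.dim (C \<inter> homogeneous_part d)"
      using dim_in[OF \<open>homogeneous_ideal J\<close>, of d] by linarith
  qed (use \<open>C \<subseteq> initial_ideal \<sigma> J\<close> C in
      \<open>auto intro: finite_span_homogeneous_part mpoly.subspace_inter subspace_ideal
        subspace_homogeneous_part\<close>)
  \<comment> \<open>The terms of an element of \<open>in(J)\<close> again lie in \<open>in(J)\<close>, and each of them is homogeneous.\<close>
  show "initial_ideal \<sigma> J \<subseteq> C"
  proof
    fix f assume f: "f \<in> initial_ideal \<sigma> J"
    have "Poly_Mapping.single m (Poly_Mapping.lookup f m) \<in> C" if "m \<in> Poly_Mapping.keys f" for m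
    proof -
      have "Poly_Mapping.single m (Poly_Mapping.lookup f m)
          \<in> initial_ideal \<sigma> J \<inter> homogeneous_part (int (mon_degree m))"
        using f that by (auto simp: in_eq homogeneous_part_def)
      then show ?thesis
        using parts by blast
    qed
    then have "(\<Sum>m\<in>Poly_Mapping.keys f. Poly_Mapping.single m (Poly_Mapping.lookup f m)) \<in> C"
      by (intro mpoly.subspace_sum subspace_ideal[OF C])
    then show "f \<in> C"
      by (simp flip: monomial_expansion)
  qed
qed (rule \<open>C \<subseteq> initial_ideal \<sigma> J\<close>)

end
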